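(* Let $\alpha,\beta,n>0$. Then $I(p\,|\,n,\alpha,\beta)$, as a function of the coin bias $p$, is either a polynomial in $p$ of degree $2\lceil n/\alpha \rceil-2$, or is identically $1$, the latter in the case $\lceil n/(\alpha + \beta) \rceil = \lceil n/\alpha \rceil$.
   Context: The game: two players alternate turns, the first player going first. On each turn the current player tosses a biased coin (all tosses independent) with probability $p\in[0,1]$ of heads and $1-p$ of tails, and is awarded $\alpha$ points for tails and $\alpha+\beta$ points for heads. The first player to accumulate $n$ or more points wins. The values $\alpha,\beta,n$ are positive constants. $I(p\,|\,n,\alpha,\beta)$ denotes the probability that the player who goes first wins. *)

theory Defs
  imports "HOL-Probability.Probability"
begin

(* Tosses are numbered 0, 1, 2, ... in the order in which they are made; True stands for heads.
   The play is continued formally after the game is decided, which does not affect the winner. *)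

definition tosses :: "real \<Rightarrow> (nat \<Rightarrow> bool) measure" where
  "tosses p = (\<Pi>\<^sub>M i\<in>UNIV. measure_pmf (bernoulli_pmf p))"

definition points :: "real \<Rightarrow> real \<Rightarrow> bool \<Rightarrow> real" where
  "points \<alpha> \<beta> heads = (if heads then \<alpha> + \<beta> else \<alpha>)"

(* Scores after the first t tosses of the game (both players' tosses counted). *)

definition score1 :: "real \<Rightarrow> real \<Rightarrow> (nat \<Rightarrow> bool) \<Rightarrow> nat \<Rightarrow> real" where
  "score1 \<alpha> \<beta> \<omega> t = (\<Sum>i | i < t \<and> even i. points \<alpha> \<beta> (\<omega> i))"

definition score2 :: "real \<Rightarrow> real \<Rightarrow> (nat \<Rightarrow> bool) \<Rightarrow> nat \<Rightarrow> real" where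
  "score2 \<alpha> \<beta> \<omega> t = (\<Sum>i | i < t \<and> odd i. points \<alpha> \<beta> (\<omega> i))"

definition first_player_wins :: "real \<Rightarrow> real \<Rightarrow> real \<Rightarrow> (nat \<Rightarrow> bool) \<Rightarrow> bool" where
  "first_player_wins n \<alpha> \<beta> \<omega> \<longleftrightarrow>
     (\<exists>t. score1 \<alpha> \<beta> \<omega> t \<ge> n \<and> (\<forall>s\<le>t. score2 \<alpha> \<beta> \<omega> s < n))"

definition I :: "real \<Rightarrow> real \<Rightarrow> real \<Rightarrow> real \<Rightarrow> real" where
  "I p n \<alpha> \<beta> = measure (tosses p) {\<omega> \<in> space (tosses p). first_player_wins n \<alpha> \<beta> \<omega>}"

end

theory Submission
  imports Defs
begin

text \<open>
  Let f(k) be the probability that a player is still short of n after k own tosses, and let M be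
  the ceiling of n over alpha, so that f(M) = 0. The first player wins at own toss k + 1 exactly
  when that toss is decisive and the second player is short of n after k tosses; since the two
  players' tosses are independent, I is the sum of f(k)^2 - f(k + 1) f(k) over k < M.
  Each f(k) is a truncated binomial sum, hence a polynomial in p of degree at most k, and its k-th
  coefficient is, up to sign, a binomial coefficient by the formula for partial alternating sums
  of binomial coefficients. If the two ceilings differ, f(M - 1) has degree exactly M - 1, and
  its square is the only term of degree 2 M - 2 because f(M) f(M - 1) vanishes. If they agree,
  nobody can reach n in fewer than M tosses, so the first player always gets there first.
\<close>

section \<open>Events determined by finitely many tosses\<close>

lemma prob_space_tosses: "prob_space (tosses p)"
  unfolding tosses_def by (intro prob_space_PiM prob_space_measure_pmf)

lemma space_tosses [simp]: "space (tosses p) = UNIV"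
  by (simp add: tosses_def space_PiM PiE_UNIV_domain)

lemma cylinder_tosses:
  assumes "p \<in> {0..1}" "finite J" "S \<subseteq> J"
  shows "{\<omega>. {i\<in>J. \<omega> i} = S} \<in> sets (tosses p)"
    and "measure (tosses p) {\<omega>. {i\<in>J. \<omega> i} = S} = p ^ card S * (1 - p) ^ card (J - S)"
proof -
  interpret product_prob_space "\<lambda>_::nat. measure_pmf (bernoulli_pmf p)" UNIV
    by unfold_locales
  \<comment> \<open>A singleton of a truth value: \<open>{True}\<close> for \<open>i\<close> in
    \<open>S\<close>, \<open>{False}\<close> otherwise.\<close>
  let ?X = "\<lambda>i. {i \<in> S}"
  have eq: "{\<omega>. {i\<in>J. \<omega> i} = S} =
      prod_emb UNIV (\<lambda>_. measure_pmf (bernoulli_pmf p)) J (\<Pi>\<^sub>E i\<in>J. ?X i)"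
    using \<open>S \<subseteq> J\<close> by (auto simp: prod_emb_def space_PiM PiE_UNIV_domain PiE_iff)
  show "{\<omega>. {i\<in>J. \<omega> i} = S} \<in> sets (tosses p)"
    unfolding eq tosses_def using \<open>finite J\<close> by (intro sets_PiM_I) auto
  have "measure (tosses p) {\<omega>. {i\<in>J. \<omega> i} = S} =
      (\<Prod>i\<in>J. measure (measure_pmf (bernoulli_pmf p)) (?X i))"
    unfolding eq tosses_def using \<open>finite J\<close> by (intro measure_PiM_emb) auto
  also have "\<dots> = (\<Prod>i\<in>J. if i \<in> S then p else 1 - p)"
    using assms(1) by (intro prod.cong) (auto simp: measure_pmf_single)
  also have "\<dots> = p ^ card S * (1 - p) ^ card (J - S)"
    using assms(2,3) by (simp add: prod.If_cases Int_absorb1 set_diff_eq Collect_conj_eq Compl_eq)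
  finally show "measure (tosses p) {\<omega>. {i\<in>J. \<omega> i} = S} = p ^ card S * (1 - p) ^ card (J - S)" .
qed

text \<open>Such an event is a finite disjoint union of cylinders, one for each admissible set of
  heads.\<close>

lemma finitary_event_tosses:
  assumes "p \<in> {0..1}" "finite J"
  shows "{\<omega>. Q {i\<in>J. \<omega> i}} \<in> sets (tosses p)"
    and "measure (tosses p) {\<omega>. Q {i\<in>J. \<omega> i}} =
      (\<Sum>S | S \<subseteq> J \<and> Q S. p ^ card S * (1 - p) ^ card (J - S))"
proof -
  interpret prob_space "tosses p" by (rule prob_space_tosses)
  have eq: "{\<omega>. Q {i\<in>J. \<omega> i}} = (\<Union>S\<in>{S. S \<subseteq> J \<and> Q S}. {\<omega>. {i\<in>J. \<omega> i} = S})"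
    by auto
  have fin: "finite {S. S \<subseteq> J \<and> Q S}" using \<open>finite J\<close> by simp
  show "{\<omega>. Q {i\<in>J. \<omega> i}} \<in> sets (tosses p)"
    unfolding eq using assms fin by (intro sets.finite_UN cylinder_tosses(1)) auto
  have "measure (tosses p) {\<omega>. Q {i\<in>J. \<omega> i}} =
      (\<Sum>S | S \<subseteq> J \<and> Q S. measure (tosses p) {\<omega>. {i\<in>J. \<omega> i} = S})"
    unfolding eq using assms fin
    by (intro finite_measure_finite_Union) (auto simp: disjoint_family_on_def intro!: cylinder_tosses(1))
  also have "\<dots> = (\<Sum>S | S \<subseteq> J \<and> Q S. p ^ card S * (1 - p) ^ card (J - S))"
    using assms by (intro sum.cong cylinder_tosses(2)) auto
  finally show "measure (tosses p) {\<omega>. Q {i\<in>J. \<omega> i}} =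
      (\<Sum>S | S \<subseteq> J \<and> Q S. p ^ card S * (1 - p) ^ card (J - S))" .
qed

section \<open>Head counts and binomial polynomials\<close>

lemma sum_subsets_by_card:
  fixes g :: "nat \<Rightarrow> real"
  assumes "finite A"
  shows "(\<Sum>S | S \<subseteq> A \<and> Q (card S). g (card S)) =
    (\<Sum>h | h \<le> card A \<and> Q h. of_nat (card A choose h) * g h)"
proof -
  have "(\<Sum>S | S \<subseteq> A \<and> Q (card S). g (card S)) =
      (\<Sum>h | h \<le> card A \<and> Q h. \<Sum>S | S \<in> {S. S \<subseteq> A \<and> Q (card S)} \<and> card S = h. g (card S))"
    using assms by (intro sum.group [symmetric]) (auto intro: card_mono)
  also have "\<dots> = (\<Sum>h | h \<le> card A \<and> Q h. \<Sum>S | S \<subseteq> A \<and> card S = h. g h)"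
    by (intro sum.cong) auto
  also have "\<dots> = (\<Sum>h | h \<le> card A \<and> Q h. of_nat (card A choose h) * g h)"
    using assms by (simp add: n_subsets)
  finally show ?thesis .
qed

text \<open>Probability that a binomial variable with parameters \<open>k\<close> and
  \<open>p\<close> satisfies \<open>Q\<close>, kept as a polynomial in \<open>p\<close> so that its
  degree makes sense.\<close>

definition binomial_prob :: "nat \<Rightarrow> (nat \<Rightarrow> bool) \<Rightarrow> real poly" where
  "binomial_prob k Q =
    (\<Sum>h | h \<le> k \<and> Q h. smult (of_nat (k choose h)) ([:0, 1:] ^ h * [:1, -1:] ^ (k - h)))"

lemma poly_binomial_prob:
  assumes "finite A"
  shows "(\<Sum>S | S \<subseteq> A \<and> Q (card S). p ^ card S * (1 - p) ^ card (A - S)) =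
    poly (binomial_prob (card A) Q) p"
proof -
  have "(\<Sum>S | S \<subseteq> A \<and> Q (card S). p ^ card S * (1 - p) ^ card (A - S)) =
      (\<Sum>S | S \<subseteq> A \<and> Q (card S). p ^ card S * (1 - p) ^ (card A - card S))"
    using assms by (intro sum.cong) (auto simp: card_Diff_subset finite_subset)
  also have "\<dots> = (\<Sum>h | h \<le> card A \<and> Q h. of_nat (card A choose h) * (p ^ h * (1 - p) ^ (card A - h)))"
    by (rule sum_subsets_by_card [OF assms])
  also have "\<dots> = poly (binomial_prob (card A) Q) p"
    by (simp add: binomial_prob_def poly_sum)
  finally show ?thesis .
qed

text \<open>Independence by counting: a set of heads in \<open>A \<union> B\<close> splits uniquely
  into its parts in \<open>A\<close> and \<open>B\<close>, and its weight factors
  accordingly.\<close>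

lemma measure_tosses_indep_counts:
  assumes p: "p \<in> {0..1}" and "finite A" "finite B" "A \<inter> B = {}"
  shows "{\<omega>. Q (card {i\<in>A. \<omega> i}) \<and> R (card {i\<in>B. \<omega> i})} \<in> sets (tosses p)"
    and "measure (tosses p) {\<omega>. Q (card {i\<in>A. \<omega> i}) \<and> R (card {i\<in>B. \<omega> i})} =
      poly (binomial_prob (card A) Q) p * poly (binomial_prob (card B) R) p"
proof -
  define T where "T S = (Q (card (S \<inter> A)) \<and> R (card (S \<inter> B)))" for S
  have restr: "{i \<in> A \<union> B. \<omega> i} \<inter> A = {i\<in>A. \<omega> i}" "{i \<in> A \<union> B. \<omega> i} \<inter> B = {i\<in>B. \<omega> i}" for \<omega>
    by auto
  have eq: "{\<omega>. Q (card {i\<in>A. \<omega> i}) \<and> R (card {i\<in>B. \<omega> i})} = {\<omega>. T {i \<in> A \<union> B. \<omega> i}}"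
    unfolding T_def restr ..
  have fin: "finite (A \<union> B)" using assms by simp
  show "{\<omega>. Q (card {i\<in>A. \<omega> i}) \<and> R (card {i\<in>B. \<omega> i})} \<in> sets (tosses p)"
    unfolding eq by (rule finitary_event_tosses(1) [OF p fin])
  let ?w = "\<lambda>J S. p ^ card S * (1 - p) ^ card (J - S)"
  have w_Un: "?w (A \<union> B) (S \<union> S') = ?w A S * ?w B S'" if "S \<subseteq> A" "S' \<subseteq> B" for S S'
  proof -
    have "card (S \<union> S') = card S + card S'"
      using that assms by (intro card_Un_disjoint) (auto intro: finite_subset)
    moreover have "(A \<union> B) - (S \<union> S') = (A - S) \<union> (B - S')"
      using that assms by blast
    moreover have "card ((A - S) \<union> (B - S')) = card (A - S) + card (B - S')"
      using assms by (intro card_Un_disjoint) auto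
    ultimately show ?thesis by (simp add: power_add)
  qed
  have "measure (tosses p) {\<omega>. T {i \<in> A \<union> B. \<omega> i}} = (\<Sum>S | S \<subseteq> A \<union> B \<and> T S. ?w (A \<union> B) S)"
    by (rule finitary_event_tosses(2) [OF p fin])
  also have "\<dots> = (\<Sum>(S, S') \<in> {S. S \<subseteq> A \<and> Q (card S)} \<times> {S. S \<subseteq> B \<and> R (card S)}. ?w A S * ?w B S')"
  proof (rule sum.reindex_bij_witness [of _ "\<lambda>(S, S'). S \<union> S'" "\<lambda>S. (S \<inter> A, S \<inter> B)"])
    fix S assume S: "S \<in> {S. S \<subseteq> A \<union> B \<and> T S}"
    show "(case (S \<inter> A, S \<inter> B) of (S, S') \<Rightarrow> S \<union> S') = S" using S by auto
    show "(S \<inter> A, S \<inter> B) \<in> {S. S \<subseteq> A \<and> Q (card S)} \<times> {S. S \<subseteq> B \<and> R (card S)}"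
      using S by (auto simp: T_def)
    have "S = (S \<inter> A) \<union> (S \<inter> B)" using S by auto
    then show "(case (S \<inter> A, S \<inter> B) of (S, S') \<Rightarrow> ?w A S * ?w B S') = ?w (A \<union> B) S"
      using w_Un [of "S \<inter> A" "S \<inter> B"] by simp
  next
    fix SS assume SS: "SS \<in> {S. S \<subseteq> A \<and> Q (card S)} \<times> {S. S \<subseteq> B \<and> R (card S)}"
    obtain S S' where [simp]: "SS = (S, S')" by (cases SS)
    have *: "(S \<union> S') \<inter> A = S" "(S \<union> S') \<inter> B = S'" using SS \<open>A \<inter> B = {}\<close> by auto
    show "((case SS of (S, S') \<Rightarrow> S \<union> S') \<inter> A, (case SS of (S, S') \<Rightarrow> S \<union> S') \<inter> B) = SS"
      using * by simp
    show "(case SS of (S, S') \<Rightarrow> S \<union> S') \<in> {S. S \<subseteq> A \<union> B \<and> T S}"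
      using SS * by (auto simp: T_def)
  qed
  also have "\<dots> = (\<Sum>S | S \<subseteq> A \<and> Q (card S). ?w A S) * (\<Sum>S | S \<subseteq> B \<and> R (card S). ?w B S)"
    by (simp add: sum_product sum.cartesian_product)
  also have "\<dots> = poly (binomial_prob (card A) Q) p * poly (binomial_prob (card B) R) p"
    using assms by (simp add: poly_binomial_prob)
  finally show "measure (tosses p) {\<omega>. Q (card {i\<in>A. \<omega> i}) \<and> R (card {i\<in>B. \<omega> i})} =
      poly (binomial_prob (card A) Q) p * poly (binomial_prob (card B) R) p"
    unfolding eq .
qed

section \<open>Degrees of truncated binomial sums\<close>

lemma degree_binomial_prob_le: "degree (binomial_prob k Q) \<le> k"
  unfolding binomial_prob_def
proof (rule degree_sum_le)
  fix h assume "h \<in> {h. h \<le> k \<and> Q h}"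
  then have "h \<le> k" by simp
  have "degree ([:0, 1:] ^ h * [:1, -1:] ^ (k - h) :: real poly) \<le> k"
    using degree_mult_le [of "[:0, 1:] ^ h :: real poly" "[:1, -1:] ^ (k - h)"]
      degree_power_le [of "[:0, 1:] :: real poly" h] degree_power_le [of "[:1, -1:] :: real poly" "k - h"] \<open>h \<le> k\<close>
    by simp
  then show "degree (smult (of_nat (k choose h)) ([:0, 1:] ^ h * [:1, -1:] ^ (k - h)) :: real poly) \<le> k"
    by (meson degree_smult_le order_trans)
qed auto

lemma coeff_power_times_power_top:
  assumes "h \<le> k"
  shows "coeff ([:0, 1:] ^ h * [:1, -1:] ^ (k - h) :: real poly) k = (-1) ^ (k - h)"
proof -
  have d: "degree ([:0, 1:] ^ h :: real poly) = h" "degree ([:1, -1:] ^ (k - h) :: real poly) = k - h"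
    by (simp_all add: degree_power_eq)
  show ?thesis
    using coeff_mult_degree_sum [of "[:0, 1:] ^ h :: real poly" "[:1, -1:] ^ (k - h)"] assms
      lead_coeff_power [of "[:0, 1:] :: real poly" h] lead_coeff_power [of "[:1, -1:] :: real poly" "k - h"]
    by (simp add: d)
qed

lemma degree_binomial_prob_atMost:
  assumes "d < k"
  shows "degree (binomial_prob k (\<lambda>h. h \<le> d)) = k"
proof -
  have "coeff (binomial_prob k (\<lambda>h. h \<le> d)) k =
      (\<Sum>h | h \<le> k \<and> h \<le> d. of_nat (k choose h) * (-1) ^ (k - h))"
    by (simp add: binomial_prob_def coeff_sum coeff_power_times_power_top)
  also have "\<dots> = (\<Sum>h\<le>d. (-1) ^ k * ((of_nat k gchoose h) * (-1) ^ h))"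
    using assms by (intro sum.cong) (auto simp: binomial_gbinomial power_diff' minus_one_power_iff)
  also have "\<dots> = (-1) ^ k * ((-1) ^ d * (of_nat k - 1 gchoose d))"
    by (simp add: sum_distrib_left [symmetric] gbinomial_sum_lower_neg)
  also have "(of_nat k - 1 gchoose d :: real) = of_nat ((k - 1) choose d)"
    using assms by (simp add: binomial_gbinomial of_nat_diff)
  \<comment> \<open>The binomial coefficient is nonzero since \<open>d \<le> k - 1\<close>.\<close>
  finally have "coeff (binomial_prob k (\<lambda>h. h \<le> d)) k \<noteq> 0"
    using assms by simp
  then show ?thesis
    using degree_binomial_prob_le le_degree by (metis le_antisym)
qed

section \<open>Scores in terms of head counts\<close>

lemma score1_eq:
  "score1 \<alpha> \<beta> \<omega> t = of_nat ((t + 1) div 2) * \<alpha> + of_nat (card {i \<in> (*) 2 ` {..<(t + 1) div 2}. \<omega> i}) * \<beta>"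
proof -
  \<comment> \<open>Rounding up reflects that the first player moves first.\<close>
  have "{i. i < t \<and> even i} = (*) 2 ` {..<(t + 1) div 2}" (is "?L = ?R")
    by (auto elim!: evenE)
  moreover have "card ?R = (t + 1) div 2"
    by (simp add: card_image inj_on_def)
  moreover have "points \<alpha> \<beta> b = \<alpha> + (if b then \<beta> else 0)" for b
    by (simp add: points_def)
  ultimately show ?thesis
    by (simp add: score1_def sum.distrib sum.If_cases Int_def)
qed

lemma score2_eq:
  "score2 \<alpha> \<beta> \<omega> t = of_nat (t div 2) * \<alpha> + of_nat (card {i \<in> (\<lambda>j. 2 * j + 1) ` {..<t div 2}. \<omega> i}) * \<beta>"
proof -
  have "{i. i < t \<and> odd i} = (\<lambda>j. 2 * j + 1) ` {..<t div 2}" (is "?L = ?R")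
    by (auto elim!: oddE)
  moreover have "card ?R = t div 2"
    by (simp add: card_image inj_on_def)
  moreover have "points \<alpha> \<beta> b = \<alpha> + (if b then \<beta> else 0)" for b
    by (simp add: points_def)
  ultimately show ?thesis
    by (simp add: score2_def sum.distrib sum.If_cases Int_def)
qed

text \<open>A predicate on the head count \<open>h\<close>, so that it can serve as \<open>Q\<close>
  in \<open>binomial_prob\<close>.\<close>

definition short_of :: "real \<Rightarrow> real \<Rightarrow> real \<Rightarrow> nat \<Rightarrow> nat \<Rightarrow> bool" where
  "short_of n \<alpha> \<beta> k h \<longleftrightarrow> of_nat k * \<alpha> + of_nat h * \<beta> < n"

text \<open>Own toss j of the first (second) player is toss 2 j (respectively 2 j + 1) of the game.\<close>

definition tosses1 :: "nat \<Rightarrow> nat set" where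
  "tosses1 k = (*) 2 ` {..<k}"

definition tosses2 :: "nat \<Rightarrow> nat set" where
  "tosses2 k = (\<lambda>j. 2 * j + 1) ` {..<k}"

lemma tosses12 [simp]:
  "finite (tosses1 k)" "finite (tosses2 k)" "card (tosses1 k) = k" "card (tosses2 k) = k"
  "tosses1 k \<inter> tosses2 l = {}"
  by (auto simp: tosses1_def tosses2_def card_image inj_on_def) presburger

lemma score1_less_iff:
  "score1 \<alpha> \<beta> \<omega> t < n \<longleftrightarrow> short_of n \<alpha> \<beta> ((t + 1) div 2) (card {i \<in> tosses1 ((t + 1) div 2). \<omega> i})"
  by (simp add: score1_eq short_of_def tosses1_def)

lemma score2_less_iff:
  "score2 \<alpha> \<beta> \<omega> t < n \<longleftrightarrow> short_of n \<alpha> \<beta> (t div 2) (card {i \<in> tosses2 (t div 2). \<omega> i})"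
  by (simp add: score2_eq short_of_def tosses2_def)

section \<open>Decomposition of the game by rounds\<close>

context
  fixes \<alpha> \<beta> n :: real
  assumes pos: "\<alpha> > 0" "\<beta> > 0" "n > 0"
begin

text \<open>
  Let f(k) be the probability that a player is still short of n after k own tosses, and let M be
  the ceiling of n over alpha, so that f(M) = 0. The first player wins at own toss k + 1 exactly
  when that toss is decisive and the second player is short of n after k tosses; since the two
  players' tosses are independent, I is the sum of f(k)^2 - f(k + 1) f(k) over k < M.
  Each f(k) is a truncated binomial sum, hence a polynomial in p of degree at most k, and its k-th
  coefficient is, up to sign, a binomial coefficient by the formula for partial alternating sums
  of binomial coefficients. If the two ceilings differ, f(M - 1) has degree exactly M - 1, and
  its square is the only term of degree 2 M - 2 because f(M) f(M - 1) vanishes. If they agree,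
  nobody can reach n in fewer than M tosses, so the first player always gets there first.
\<close>

lemma points_nonneg: "points \<alpha> \<beta> b \<ge> 0"
  using pos by (simp add: points_def)

lemma score1_mono: "s \<le> t \<Longrightarrow> score1 \<alpha> \<beta> \<omega> s \<le> score1 \<alpha> \<beta> \<omega> t"
  unfolding score1_def by (intro sum_mono2) (auto simp: points_nonneg)

lemma score2_mono: "s \<le> t \<Longrightarrow> score2 \<alpha> \<beta> \<omega> s \<le> score2 \<alpha> \<beta> \<omega> t"
  unfolding score2_def by (intro sum_mono2) (auto simp: points_nonneg)

abbreviation short1 :: "nat \<Rightarrow> (nat \<Rightarrow> bool) \<Rightarrow> bool" where
  "short1 k \<omega> \<equiv> short_of n \<alpha> \<beta> k (card {i \<in> tosses1 k. \<omega> i})"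

abbreviation short2 :: "nat \<Rightarrow> (nat \<Rightarrow> bool) \<Rightarrow> bool" where
  "short2 k \<omega> \<equiv> short_of n \<alpha> \<beta> k (card {i \<in> tosses2 k. \<omega> i})"

lemma short1_antimono:
  assumes "k \<le> l" "short1 l \<omega>"
  shows "short1 k \<omega>"
  using score1_less_iff [of \<alpha> \<beta> \<omega> "2 * k" n] score1_less_iff [of \<alpha> \<beta> \<omega> "2 * l" n]
    score1_mono [of "2 * k" "2 * l" \<omega>] assms by simp

text \<open>Passes from game time to rounds. Here \<open>k\<close> need not be the deciding round;
  minimality is imposed only when disjoint events are required.\<close>

lemma first_player_wins_iff:
  "first_player_wins n \<alpha> \<beta> \<omega> \<longleftrightarrow> (\<exists>k. \<not> short1 (Suc k) \<omega> \<and> short2 k \<omega>)"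
proof
  assume "first_player_wins n \<alpha> \<beta> \<omega>"
  then obtain t where t: "score1 \<alpha> \<beta> \<omega> t \<ge> n" "score2 \<alpha> \<beta> \<omega> t < n"
    unfolding first_player_wins_def by blast
  have "score1 \<alpha> \<beta> \<omega> 0 = 0" by (simp add: score1_def)
  then have "t \<noteq> 0" using t(1) pos by (metis not_le)
  \<comment> \<open>The round containing toss \<open>t - 1\<close>, the last one counted at time
    \<open>t\<close>.\<close>
  define k where "k = (t - 1) div 2"
  have le: "t \<le> 2 * k + 2" "2 * k \<le> t" using \<open>t \<noteq> 0\<close> by (auto simp: k_def)
  have "\<not> score1 \<alpha> \<beta> \<omega> (2 * k + 2) < n" "score2 \<alpha> \<beta> \<omega> (2 * k) < n"
    using t score1_mono [OF le(1), of \<omega>] score2_mono [OF le(2), of \<omega>] by linarith+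
  then have "\<not> short1 (Suc k) \<omega> \<and> short2 k \<omega>"
    unfolding score1_less_iff score2_less_iff by simp
  then show "\<exists>k. \<not> short1 (Suc k) \<omega> \<and> short2 k \<omega>" ..
next
  assume "\<exists>k. \<not> short1 (Suc k) \<omega> \<and> short2 k \<omega>"
  then obtain k where k: "\<not> short1 (Suc k) \<omega>" "short2 k \<omega>" by blast
  have "score1 \<alpha> \<beta> \<omega> (2 * k + 1) \<ge> n"
    using k(1) score1_less_iff [of \<alpha> \<beta> \<omega> "2 * k + 1" n] by simp
  moreover have "score2 \<alpha> \<beta> \<omega> (2 * k + 1) < n"
    using k(2) score2_less_iff [of \<alpha> \<beta> \<omega> "2 * k + 1" n] by simp
  then have "\<forall>s\<le>2 * k + 1. score2 \<alpha> \<beta> \<omega> s < n"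
    using score2_mono order.strict_trans1 by metis
  ultimately show "first_player_wins n \<alpha> \<beta> \<omega>"
    unfolding first_player_wins_def by blast
qed

abbreviation short_poly :: "nat \<Rightarrow> real poly" where
  "short_poly k \<equiv> binomial_prob k (short_of n \<alpha> \<beta> k)"

lemma not_short_of: "of_nat k * \<alpha> \<ge> n \<Longrightarrow> \<not> short_of n \<alpha> \<beta> k h"
  using pos by (simp add: short_of_def not_less add_increasing2)

lemma I_eq_poly:
  assumes p: "p \<in> {0..1}" and M: "of_nat M * \<alpha> \<ge> n"
  shows "I p n \<alpha> \<beta> =
    poly (\<Sum>k<M. short_poly k * short_poly k - short_poly (Suc k) * short_poly k) p"
proof -
  interpret prob_space "tosses p" by (rule prob_space_tosses)
  define E where "E k l = {\<omega>. short1 k \<omega> \<and> short2 l \<omega>}" for k l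
  have E: "E k l \<in> events" "prob (E k l) = poly (short_poly k) p * poly (short_poly l) p" for k l
    unfolding E_def
    using measure_tosses_indep_counts [OF p, of "tosses1 k" "tosses2 l" "short_of n \<alpha> \<beta> k" "short_of n \<alpha> \<beta> l"]
    by simp_all
  \<comment> \<open>The first player reaches \<open>n\<close> exactly at own toss
    \<open>k + 1\<close>, the second being short after \<open>k\<close>. The subtracted event is
    contained in the other, so probabilities subtract.\<close>
  define W where "W k = E k k - E (Suc k) k" for k
  have W: "prob (W k) = poly (short_poly k * short_poly k - short_poly (Suc k) * short_poly k) p" for k
  proof -
    have "E (Suc k) k \<subseteq> E k k"
      using short1_antimono [of k "Suc k"] by (auto simp: E_def)
    then show ?thesis
      unfolding W_def by (simp add: finite_measure_Diff E)
  qed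
  have "first_player_wins n \<alpha> \<beta> \<omega> \<longleftrightarrow> (\<exists>k<M. \<omega> \<in> W k)" for \<omega>
  proof
    assume "first_player_wins n \<alpha> \<beta> \<omega>"
    then obtain k where k: "\<not> short1 (Suc k) \<omega>" "short2 k \<omega>"
      and least: "\<And>j. j < k \<Longrightarrow> \<not> (\<not> short1 (Suc j) \<omega> \<and> short2 j \<omega>)"
      unfolding first_player_wins_iff
        exists_least_iff [of "\<lambda>k. \<not> short1 (Suc k) \<omega> \<and> short2 k \<omega>"]
      by (elim exE conjE) simp
    have short2_antimono: "short2 j \<omega>" if "j \<le> k" for j
      using score2_less_iff [of \<alpha> \<beta> \<omega> "2 * j" n] score2_less_iff [of \<alpha> \<beta> \<omega> "2 * k" n]
        score2_mono [of "2 * j" "2 * k" \<omega>] that k(2) by simp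
    \<comment> \<open>Otherwise the previous round would already witness the win, contradicting
      minimality of \<open>k\<close>.\<close>
    have "short1 k \<omega>"
    proof (cases k)
      case 0
      then show ?thesis using pos by (simp add: short_of_def tosses1_def)
    next
      case (Suc j)
      then show ?thesis using least [of j] short2_antimono [of j] by simp
    qed
    moreover have "k < M"
      using short1_antimono [of M k \<omega>] not_short_of [OF M] \<open>short1 k \<omega>\<close> by (meson not_le)
    ultimately show "\<exists>k<M. \<omega> \<in> W k" using k by (auto simp: W_def E_def)
  next
    assume "\<exists>k<M. \<omega> \<in> W k"
    then show "first_player_wins n \<alpha> \<beta> \<omega>"
      unfolding first_player_wins_iff by (auto simp: W_def E_def)
  qed
  then have "I p n \<alpha> \<beta> = prob (\<Union>k<M. W k)"
    unfolding I_def by (intro arg_cong [where f = prob]) auto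
  also have "\<dots> = (\<Sum>k<M. prob (W k))"
  proof (rule finite_measure_finite_Union)
    \<comment> \<open>\<open>W k\<close> forces the first player to have \<open>n\<close> points
      after \<open>Suc k \<le> l\<close> own tosses, while \<open>W l\<close> forces a shortfall
      after \<open>l\<close>.\<close>
    have "W k \<inter> W l = {}" if "k < l" for k l
      using that short1_antimono [of "Suc k" l] by (auto simp: W_def E_def)
    then show "disjoint_family_on W {..<M}"
      unfolding disjoint_family_on_def by (metis Int_commute linorder_neqE_nat)
  qed (auto simp: W_def intro!: E)
  finally show ?thesis by (simp add: W poly_sum)
qed

text \<open>Being short is a bound \<open>h \<le> d\<close> on the heads: the first hypothesis gives
  \<open>d \<ge> 0\<close>, the second \<open>d < k\<close>, so the truncation is proper.\<close>

lemma degree_short_poly: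
  assumes "of_nat k * \<alpha> < n" "n \<le> of_nat k * (\<alpha> + \<beta>)"
  shows "degree (short_poly k) = k"
proof -
  \<comment> \<open>The least number of heads that brings \<open>k\<close> tosses to
    \<open>n\<close> points.\<close>
  define c where "c = \<lceil>(n - of_nat k * \<alpha>) / \<beta>\<rceil>"
  define d where "d = nat (c - 1)"
  have "c > 0" using assms(1) pos by (simp add: c_def)
  have "c \<le> int k"
    using assms(2) pos by (simp add: c_def ceiling_le_iff field_simps)
  have "short_of n \<alpha> \<beta> k h \<longleftrightarrow> h \<le> d" for h
  proof -
    have "short_of n \<alpha> \<beta> k h \<longleftrightarrow> int h < c"
      using pos by (simp add: short_of_def c_def less_ceiling_iff field_simps)
    then show ?thesis using \<open>c > 0\<close> by (auto simp: d_def)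
  qed
  then have "short_of n \<alpha> \<beta> k = (\<lambda>h. h \<le> d)" by blast
  moreover have "d < k" using \<open>c > 0\<close> \<open>c \<le> int k\<close> by (simp add: d_def)
  ultimately show ?thesis by (simp add: degree_binomial_prob_atMost)
qed

end

theorem corollary3:
  fixes \<alpha> \<beta> n :: real
  assumes "\<alpha> > 0" and "\<beta> > 0" and "n > 0"
  shows "if \<lceil>n / (\<alpha> + \<beta>)\<rceil> = \<lceil>n / \<alpha>\<rceil>
         then \<forall>p\<in>{0..1}. I p n \<alpha> \<beta> = 1
         else \<exists>P :: real poly. int (degree P) = 2 * \<lceil>n / \<alpha>\<rceil> - 2 \<and>
                (\<forall>p\<in>{0..1}. I p n \<alpha> \<beta> = poly P p)"
proof -
  \<comment> \<open>All tails for \<open>N\<close> own tosses falls short of \<open>n\<close>, while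
    \<open>N + 1\<close> own tosses always suffice.\<close>
  define N where "N = nat (\<lceil>n / \<alpha>\<rceil> - 1)"
  have "\<lceil>n / \<alpha>\<rceil> > 0" using assms by simp
  then have ceil: "\<lceil>n / \<alpha>\<rceil> = int N + 1" by (simp add: N_def)
  then have N: "of_nat N * \<alpha> < n" "n \<le> of_nat (Suc N) * \<alpha>"
    using assms by (auto simp: ceiling_eq_iff field_simps)
  have ceil_le: "\<lceil>n / (\<alpha> + \<beta>)\<rceil> \<le> \<lceil>n / \<alpha>\<rceil>"
    using assms by (intro ceiling_mono divide_left_mono) auto
  show ?thesis
  proof (cases "\<lceil>n / (\<alpha> + \<beta>)\<rceil> = \<lceil>n / \<alpha>\<rceil>")
    case True
    then have "\<lceil>n / (\<alpha> + \<beta>)\<rceil> = int N + 1" using ceil by simp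
    then have less: "of_nat N * (\<alpha> + \<beta>) < n"
      using assms by (auto simp: ceiling_eq_iff field_simps)
    \<comment> \<open>Even \<open>N\<close> heads leave the second player short, and the first
      player is done by own toss \<open>N + 1\<close>.\<close>
    have "first_player_wins n \<alpha> \<beta> \<omega>" for \<omega>
    proof -
      have "card {i \<in> tosses2 N. \<omega> i} \<le> card (tosses2 N)"
        by (intro card_mono) auto
      then have "of_nat (card {i \<in> tosses2 N. \<omega> i}) * \<beta> \<le> of_nat N * \<beta>"
        using assms by (intro mult_right_mono) auto
      then have "short_of n \<alpha> \<beta> N (card {i \<in> tosses2 N. \<omega> i})"
        using less by (simp add: short_of_def distrib_left)
      then show ?thesis
        using first_player_wins_iff [OF assms] not_short_of [OF assms N(2)] by blast
    qed
    then have "I p n \<alpha> \<beta> = 1" for p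
      using prob_space.prob_space [OF prob_space_tosses, of p] by (simp add: I_def)
    then show ?thesis using True by simp
  next
    case False
    then have "\<lceil>n / (\<alpha> + \<beta>)\<rceil> \<le> int N" using ceil ceil_le by linarith
    then have ge: "n \<le> of_nat N * (\<alpha> + \<beta>)"
      using assms by (simp add: ceiling_le_iff field_simps)
    then have "N > 0" using assms by (cases N) auto
    let ?f = "\<lambda>k. binomial_prob k (short_of n \<alpha> \<beta> k)"
    let ?P = "\<Sum>k<Suc N. ?f k * ?f k - ?f (Suc k) * ?f k"
    have "?f (Suc N) = 0"
      using not_short_of [OF assms N(2)] by (simp add: binomial_prob_def)
    then have P: "?P = ?f N * ?f N + (\<Sum>k<N. ?f k * ?f k - ?f (Suc k) * ?f k)"
      by simp
    have top: "degree (?f N * ?f N) = 2 * N"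
      using degree_short_poly [OF assms N(1) ge] \<open>N > 0\<close>
      by (subst degree_mult_eq) auto
    \<comment> \<open>For \<open>k < N\<close> the products have degree at most
      \<open>2 * k + 1\<close>, so they cannot cancel the leading term of
      \<open>?f N * ?f N\<close>.\<close>
    have "degree (\<Sum>k<N. ?f k * ?f k - ?f (Suc k) * ?f k) \<le> 2 * N - 1"
    proof (intro degree_sum_le degree_diff_le)
      fix k assume "k \<in> {..<N}"
      then show "degree (?f k * ?f k) \<le> 2 * N - 1" "degree (?f (Suc k) * ?f k) \<le> 2 * N - 1"
        using degree_mult_le [of "?f k" "?f k"] degree_mult_le [of "?f (Suc k)" "?f k"]
          degree_binomial_prob_le [of k "short_of n \<alpha> \<beta> k"]
          degree_binomial_prob_le [of "Suc k" "short_of n \<alpha> \<beta> (Suc k)"] by auto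
    qed auto
    then have "degree ?P = 2 * N"
      unfolding P using top \<open>N > 0\<close> by (subst degree_add_eq_left) auto
    then have "int (degree ?P) = 2 * \<lceil>n / \<alpha>\<rceil> - 2" using ceil by simp
    moreover have "\<forall>p\<in>{0..1}. I p n \<alpha> \<beta> = poly ?P p"
      using I_eq_poly [OF assms _ N(2)] by blast
    ultimately show ?thesis using False by auto
  qed
qed

end
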